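(* Let $0<\varphi\le\frac{\pi}{2}$, $c=\cos\varphi$, $s=\sin\varphi=\sqrt{1-c^2}$, and consider cubic $G^1$ approximants, with parameter $\xi>0$, of the circular arc $\alpha\mapsto(\cos\alpha,\sin\alpha)^T$, $\alpha\in[-\varphi,\varphi]$. The unique optimal outer approximant is given by $$\xi^\land=\frac{4\sqrt{1-c^2}}{3(1+c)},$$ and the unique optimal inner approximant is given by $$\xi^\lor=\tfrac23\sqrt{1-c^2}\,\bigl(\sqrt{3+c^2}-c\bigr).$$
   Context: For real $\xi>0$, the cubic $G^1$ approximant with parameter $\xi$ is the curve $p:[-1,1]\to\mathbb{R}^2$, $p(t)=\sum_{i=0}^3\binom{3}{i}\left(\frac{1+t}{2}\right)^i\left(\frac{1-t}{2}\right)^{3-i}b_i$, with control points $b_0=(c,-s)^T$, $b_1=(c,-s)^T+\xi(s,c)^T$, $b_2=(c,s)^T+\xi(s,-c)^T$, $b_3=(c,s)^T$. Its simplified radial error function is $\psi(t,\xi)=\|p(t)\|_2^2-1$. The approximant is inner if $\psi(t,\xi)\le0$ for all $t\in[-1,1]$, and outer if $\psi(t,\xi)\ge0$ for all $t\in[-1,1]$. An inner (outer) approximant is optimal if it minimizes $\max_{t\in[-1,1]}|\psi(t,\xi)|$ among all inner (outer) approximants of this form. *)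

theory Defs
  imports "HOL-Analysis.Analysis"
begin

text \<open>
  The circular arc is \<open>\<alpha> \<mapsto> (cos \<alpha>, sin \<alpha>)\<close> on \<open>[-\<phi>, \<phi>]\<close>, so it enters only through
  its half-angle \<open>\<phi>\<close>, with \<open>c = cos \<phi>\<close> and \<open>s = sin \<phi>\<close>.
\<close>

definition control_point :: "real \<Rightarrow> real \<Rightarrow> nat \<Rightarrow> real^2" where
  "control_point \<phi> \<xi> i =
    (let c = cos \<phi>; s = sin \<phi> in
     [ vector [c, - s],
       vector [c, - s] + \<xi> *\<^sub>R vector [s, c],
       vector [c, s] + \<xi> *\<^sub>R vector [s, - c],
       vector [c, s] ] ! i)"

definition G1_curve :: "real \<Rightarrow> real \<Rightarrow> real \<Rightarrow> real^2" where
  "G1_curve \<phi> \<xi> t =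
    (\<Sum>i = 0..3. (real (3 choose i) * ((1 + t) / 2) ^ i * ((1 - t) / 2) ^ (3 - i))
        *\<^sub>R control_point \<phi> \<xi> i)"

definition radial_error :: "real \<Rightarrow> real \<Rightarrow> real \<Rightarrow> real" where
  "radial_error \<phi> t \<xi> = (norm (G1_curve \<phi> \<xi> t))\<^sup>2 - 1"

definition inner_approximant :: "real \<Rightarrow> real \<Rightarrow> bool" where
  "inner_approximant \<phi> \<xi> \<longleftrightarrow> \<xi> > 0 \<and> (\<forall>t\<in>{-1..1}. radial_error \<phi> t \<xi> \<le> 0)"

definition outer_approximant :: "real \<Rightarrow> real \<Rightarrow> bool" where
  "outer_approximant \<phi> \<xi> \<longleftrightarrow> \<xi> > 0 \<and> (\<forall>t\<in>{-1..1}. radial_error \<phi> t \<xi> \<ge> 0)"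

text \<open>
  The radial error is continuous in \<open>t\<close>, so this supremum over a compact interval is attained
  and equals the maximum.
\<close>

definition max_radial_error :: "real \<Rightarrow> real \<Rightarrow> real" where
  "max_radial_error \<phi> \<xi> = (SUP t\<in>{-1..1}. \<bar>radial_error \<phi> t \<xi>\<bar>)"

definition optimal_inner :: "real \<Rightarrow> real \<Rightarrow> bool" where
  "optimal_inner \<phi> \<xi> \<longleftrightarrow> inner_approximant \<phi> \<xi> \<and>
    (\<forall>\<eta>. inner_approximant \<phi> \<eta> \<longrightarrow> max_radial_error \<phi> \<xi> \<le> max_radial_error \<phi> \<eta>)"

definition optimal_outer :: "real \<Rightarrow> real \<Rightarrow> bool" where
  "optimal_outer \<phi> \<xi> \<longleftrightarrow> outer_approximant \<phi> \<xi> \<and>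
    (\<forall>\<eta>. outer_approximant \<phi> \<eta> \<longrightarrow> max_radial_error \<phi> \<xi> \<le> max_radial_error \<phi> \<eta>)"

end

theory Submission imports Defs begin

text \<open>
  With \<open>u = 1 - t\<^sup>2\<close> and \<open>a = 3\<xi>/4\<close> the radial error collapses to \<open>u\<^sup>2 (A - q\<^sup>2 u)\<close>, where
  \<open>A = a\<^sup>2 + a c s - 3 s\<^sup>2/4\<close> and \<open>q = s/2 - a c\<close>. For fixed \<open>u > 0\<close> it is strictly increasing in
  \<open>\<xi> > 0\<close>, so the outer approximants form a ray \<open>\<xi> \<ge> \<xi>\<^sub>o\<close> and the inner ones an interval
  \<open>0 < \<xi> \<le> \<xi>\<^sub>i\<close>, and on either set the error increases pointwise in absolute value with the
  distance from the endpoint. The endpoint \<open>\<xi>\<^sub>o\<close> is where the error vanishes at \<open>u = 1\<close> (\<open>A = q\<^sup>2\<close>),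
  the endpoint \<open>\<xi>\<^sub>i\<close> is where its leading coefficient at \<open>u = 0\<close> vanishes (\<open>A = 0\<close>).
\<close>

section \<open>Closed form of the radial error\<close>

definition edge_coeff :: "real \<Rightarrow> real \<Rightarrow> real" where
  "edge_coeff \<phi> \<xi> = (3 * \<xi> / 4)\<^sup>2 + 3 * \<xi> / 4 * cos \<phi> * sin \<phi> - 3 * (sin \<phi>)\<^sup>2 / 4"

definition cubic_coeff :: "real \<Rightarrow> real \<Rightarrow> real" where
  "cubic_coeff \<phi> \<xi> = (sin \<phi> / 2 - 3 * \<xi> / 4 * cos \<phi>)\<^sup>2"

lemma cubic_coeff_nonneg: "0 \<le> cubic_coeff \<phi> \<xi>"
  by (simp add: cubic_coeff_def)

text \<open>The two middle Bernstein polynomials have sum \<open>3/4 * (1 - t\<^sup>2)\<close> and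
  difference \<open>3/4 * t * (1 - t\<^sup>2)\<close>; symmetry in the horizontal axis makes the
  first coordinate even and the second odd in \<open>t\<close>.\<close>

lemma G1_curve_components:
  "G1_curve \<phi> \<xi> t $ 1 = cos \<phi> + 3 * \<xi> / 4 * sin \<phi> * (1 - t\<^sup>2)"
  "G1_curve \<phi> \<xi> t $ 2 = t * (sin \<phi> + (sin \<phi> / 2 - 3 * \<xi> / 4 * cos \<phi>) * (1 - t\<^sup>2))"
proof -
  have set: "{0..3} = {0, 1, 2, 3 :: nat}" by auto
  have choose: "(3 choose 2) = (3 :: nat)"
    by (simp add: numeral_eq_Suc)
  show "G1_curve \<phi> \<xi> t $ 1 = cos \<phi> + 3 * \<xi> / 4 * sin \<phi> * (1 - t\<^sup>2)"
    unfolding G1_curve_def set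
    by (simp add: choose control_point_def Let_def) (simp add: field_simps, algebra)
  show "G1_curve \<phi> \<xi> t $ 2 = t * (sin \<phi> + (sin \<phi> / 2 - 3 * \<xi> / 4 * cos \<phi>) * (1 - t\<^sup>2))"
    unfolding G1_curve_def set
    by (simp add: choose control_point_def Let_def) (simp add: field_simps, algebra)
qed

text \<open>Both ends lie on the circle with matching tangents, so the error has double zeros at
  \<open>t = 1\<close> and \<open>t = -1\<close>, whence the factor
  \<open>(1 - t\<^sup>2)\<^sup>2\<close>.\<close>

lemma radial_error_eq:
  "radial_error \<phi> t \<xi> = (1 - t\<^sup>2)\<^sup>2 * (edge_coeff \<phi> \<xi> - cubic_coeff \<phi> \<xi> * (1 - t\<^sup>2))"
proof -
  define c s a where "c = cos \<phi>" and "s = sin \<phi>" and "a = 3 * \<xi> / 4"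
  have cs: "s\<^sup>2 = 1 - c\<^sup>2"
    unfolding c_def s_def by (rule sin_squared_eq)
  have "radial_error \<phi> t \<xi> = (c + a * s * (1 - t\<^sup>2))\<^sup>2
      + (t * (s + (s / 2 - a * c) * (1 - t\<^sup>2)))\<^sup>2 - 1"
    unfolding radial_error_def c_def s_def a_def
    by (simp add: norm_vec_def L2_set_def sum_2 G1_curve_components)
  also have "\<dots> = (1 - t\<^sup>2)\<^sup>2 * (a\<^sup>2 + a * c * s - 3 * s\<^sup>2 / 4 - (s / 2 - a * c)\<^sup>2 * (1 - t\<^sup>2))"
    using cs by (simp add: field_simps) algebra
  finally show ?thesis
    unfolding edge_coeff_def cubic_coeff_def c_def s_def a_def .
qed

lemma radial_error_endpoint: "t\<^sup>2 = 1 \<Longrightarrow> radial_error \<phi> t \<xi> = 0"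
  by (simp add: radial_error_eq)

lemma continuous_on_radial_error: "continuous_on A (\<lambda>t. radial_error \<phi> t \<xi>)"
  unfolding radial_error_eq by (intro continuous_intros)

section \<open>Monotonicity in the parameter\<close>

text \<open>The difference of the two errors contains the factor \<open>b - a\<close>. The cofactor
  is positive because \<open>u * c\<^sup>2 < 1\<close> and, for an arc of at most a half circle,
  \<open>c * s \<ge> 0\<close>.\<close>

lemma radial_error_strict_mono:
  assumes "0 < sin \<phi>" "0 \<le> cos \<phi>" "0 < \<xi>" "\<xi> < \<eta>" "t\<^sup>2 < 1"
  shows "radial_error \<phi> t \<xi> < radial_error \<phi> t \<eta>"
proof -
  define c s a b u where "c = cos \<phi>" and "s = sin \<phi>" and "a = 3 * \<xi> / 4" and "b = 3 * \<eta> / 4"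
    and "u = 1 - t\<^sup>2"
  have u: "0 < u" "u \<le> 1" and ab: "0 < a" "a < b" and cs: "0 \<le> c" "0 < s"
    using assms by (simp_all add: u_def a_def b_def c_def s_def)
  have "c\<^sup>2 < 1"
    using cs sin_squared_eq[of \<phi>] unfolding c_def s_def by (smt (verit) zero_less_power)
  then have "u * c\<^sup>2 < 1"
    using u mult_left_le_one_le[of "c\<^sup>2" u] by simp
  then have "0 < (a + b) * (1 - u * c\<^sup>2) + c * s * (1 + u)"
    using ab cs u by (intro add_pos_nonneg) auto
  then have "0 < u\<^sup>2 * ((b - a) * ((a + b) * (1 - u * c\<^sup>2) + c * s * (1 + u)))"
    using ab u by simp
  also have "\<dots> = u\<^sup>2 * (b\<^sup>2 + b * c * s - 3 * s\<^sup>2 / 4 - (s / 2 - b * c)\<^sup>2 * u)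
      - u\<^sup>2 * (a\<^sup>2 + a * c * s - 3 * s\<^sup>2 / 4 - (s / 2 - a * c)\<^sup>2 * u)"
    by (simp add: field_simps) algebra
  finally show ?thesis
    unfolding radial_error_eq edge_coeff_def cubic_coeff_def c_def s_def a_def b_def u_def by simp
qed

lemma radial_error_mono:
  assumes "0 < sin \<phi>" "0 \<le> cos \<phi>" "0 < \<xi>" "\<xi> \<le> \<eta>" "t \<in> {-1..1}"
  shows "radial_error \<phi> t \<xi> \<le> radial_error \<phi> t \<eta>"
proof -
  have "t\<^sup>2 \<le> 1"
    using assms(5) by (simp add: abs_square_le_1 abs_le_iff)
  then consider "t\<^sup>2 = 1" | "\<xi> = \<eta>" | "t\<^sup>2 < 1" "\<xi> < \<eta>"
    using assms(4) by linarith
  then show ?thesis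
    using assms radial_error_strict_mono
    by cases (auto simp: radial_error_endpoint intro: less_imp_le)
qed

text \<open>By compactness the smaller maximum is attained, so a pointwise strict inequality passes
  to the maxima.\<close>

lemma max_radial_error_less:
  assumes less: "\<And>t. t\<^sup>2 < 1 \<Longrightarrow> \<bar>radial_error \<phi> t \<xi>\<bar> < \<bar>radial_error \<phi> t \<eta>\<bar>"
  shows "max_radial_error \<phi> \<xi> < max_radial_error \<phi> \<eta>"
proof -
  let ?I = "{-1..1 :: real}"
  have cont: "continuous_on ?I (\<lambda>t. \<bar>radial_error \<phi> t \<zeta>\<bar>)" for \<zeta>
    by (intro continuous_intros continuous_on_radial_error)
  have "bdd_above ((\<lambda>t. \<bar>radial_error \<phi> t \<eta>\<bar>) ` ?I)"
    by (intro bounded_imp_bdd_above compact_imp_bounded compact_continuous_image cont) simp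
  then have upper: "\<bar>radial_error \<phi> t \<eta>\<bar> \<le> max_radial_error \<phi> \<eta>" if "t \<in> ?I" for t
    unfolding max_radial_error_def using that by (rule cSUP_upper[rotated])
  obtain t where t: "t \<in> ?I"
      "\<And>x. x \<in> ?I \<Longrightarrow> \<bar>radial_error \<phi> x \<xi>\<bar> \<le> \<bar>radial_error \<phi> t \<xi>\<bar>"
    using continuous_attains_sup[OF _ _ cont[of \<xi>]] by auto
  have "max_radial_error \<phi> \<xi> \<le> \<bar>radial_error \<phi> t \<xi>\<bar>"
    unfolding max_radial_error_def using t by (intro cSUP_least) auto
  also have "\<dots> < max_radial_error \<phi> \<eta>"
  proof (cases "t\<^sup>2 < 1")
    case True
    then show ?thesis
      using less upper t(1) by (blast intro: less_le_trans)
  next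
    \<comment> \<open>At an endpoint both errors vanish and strictness is lost there; the comparison
      is made at \<open>t = 0\<close> instead.\<close>
    case False
    moreover have "t\<^sup>2 \<le> 1"
      using t(1) by (simp add: abs_square_le_1 abs_le_iff)
    ultimately have "\<bar>radial_error \<phi> t \<xi>\<bar> \<le> \<bar>radial_error \<phi> 0 \<xi>\<bar>"
      by (simp add: radial_error_endpoint)
    also have "\<dots> < \<bar>radial_error \<phi> 0 \<eta>\<bar>"
      by (rule less) simp
    also have "\<dots> \<le> max_radial_error \<phi> \<eta>"
      by (rule upper) simp
    finally show ?thesis .
  qed
  finally show ?thesis .
qed

section \<open>Admissible parameters\<close>

lemma outer_approximant_iff:
  assumes "0 < sin \<phi>" "0 \<le> cos \<phi>"
  shows "outer_approximant \<phi> \<xi> \<longleftrightarrow> 4 * sin \<phi> / (3 * (1 + cos \<phi>)) \<le> \<xi>"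
proof -
  define \<xi>\<^sub>o where "\<xi>\<^sub>o = 4 * sin \<phi> / (3 * (1 + cos \<phi>))"
  have pos: "0 < \<xi>\<^sub>o"
    using assms by (simp add: \<xi>\<^sub>o_def)
  define c s a where "c = cos \<phi>" and "s = sin \<phi>" and "a = 3 * \<xi>\<^sub>o / 4"
  have cs: "s\<^sup>2 = 1 - c\<^sup>2"
    unfolding c_def s_def by (rule sin_squared_eq)
  \<comment> \<open>Here \<open>a\<close> is the tangent of \<open>\<phi> / 2\<close>. The aim is
    \<open>a * s = 1 - c\<close>, which says that the curve passes through the arc's midpoint
    \<open>(1, 0)\<close> at \<open>t = 0\<close>.\<close>
  have a: "a * (1 + c) = s"
    using assms by (simp add: a_def \<xi>\<^sub>o_def c_def s_def field_simps)
  have "(1 + c) * (a * s) = a * (1 + c) * s"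
    by (simp add: algebra_simps)
  also have "\<dots> = (1 + c) * (1 - c)"
    using cs unfolding a by (simp add: algebra_simps power2_eq_square)
  finally have "(1 + c) * (a * s) = (1 + c) * (1 - c)" .
  then have "a * s = 1 - c"
    using assms by (simp add: c_def)
  then have "a\<^sup>2 + a * c * s - 3 * s\<^sup>2 / 4 = (s / 2 - a * c)\<^sup>2"
    using cs by (simp add: field_simps) algebra
  then have coeff: "edge_coeff \<phi> \<xi>\<^sub>o = cubic_coeff \<phi> \<xi>\<^sub>o"
    by (simp add: edge_coeff_def cubic_coeff_def a_def c_def s_def)
  \<comment> \<open>With equal coefficients the error is
    \<open>(1 - t\<^sup>2)\<^sup>2 * t\<^sup>2\<close> times \<open>cubic_coeff\<close>.\<close>
  have "0 \<le> radial_error \<phi> t \<xi>\<^sub>o" for t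
    unfolding radial_error_eq coeff using cubic_coeff_nonneg[of \<phi> \<xi>\<^sub>o]
    by (simp add: algebra_simps)
  then have "outer_approximant \<phi> \<xi>" if "\<xi>\<^sub>o \<le> \<xi>"
    using that pos assms unfolding outer_approximant_def
    by (meson radial_error_mono order_trans less_le_trans)
  moreover have "\<xi>\<^sub>o \<le> \<xi>" if "outer_approximant \<phi> \<xi>"
  proof (rule ccontr)
    assume "\<not> \<xi>\<^sub>o \<le> \<xi>"
    then have "radial_error \<phi> 0 \<xi> < radial_error \<phi> 0 \<xi>\<^sub>o"
      using that assms by (intro radial_error_strict_mono) (auto simp: outer_approximant_def)
    also have "\<dots> = 0"
      by (simp add: radial_error_eq coeff)
    finally show False
      using that by (simp add: outer_approximant_def not_less[symmetric])
  qed
  ultimately show ?thesis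
    unfolding \<xi>\<^sub>o_def by blast
qed

text \<open>A positive leading coefficient at \<open>u = 0\<close> would push the curve outside the
  circle near its endpoints.\<close>

lemma inner_approximant_imp_edge_coeff_nonpos:
  assumes "inner_approximant \<phi> \<xi>"
  shows "edge_coeff \<phi> \<xi> \<le> 0"
proof (rule ccontr)
  \<comment> \<open>An explicit small enough \<open>u\<close>: this choice gives
    \<open>A - Q * u = A * u > 0\<close> and stays in \<open>(0, 1]\<close>, so it comes from an
    admissible \<open>t\<close>.\<close>
  define A Q u where "A = edge_coeff \<phi> \<xi>" and "Q = cubic_coeff \<phi> \<xi>" and "u = A / (A + Q)"
  assume "\<not> edge_coeff \<phi> \<xi> \<le> 0"
  then have A: "0 < A"
    by (simp add: A_def)
  have Q: "0 \<le> Q"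
    by (simp add: Q_def cubic_coeff_nonneg)
  have u: "0 < u" "u \<le> 1"
    using A Q by (simp_all add: u_def)
  have "A - Q * u = A * u"
    using A Q by (simp add: u_def field_simps)
  then have "0 < u\<^sup>2 * (A - Q * u)"
    using A u by simp
  also have "\<dots> = radial_error \<phi> (sqrt (1 - u)) \<xi>"
    using u by (simp add: radial_error_eq A_def Q_def)
  also have "\<dots> \<le> 0"
  proof -
    have "sqrt (1 - u) \<in> {-1..1}"
      using u by (auto intro: order_trans[of _ 0])
    then show ?thesis
      using assms by (simp add: inner_approximant_def)
  qed
  finally show False by simp
qed

lemma inner_approximant_iff:
  assumes "0 < sin \<phi>" "0 \<le> cos \<phi>"
  shows "inner_approximant \<phi> \<xi> \<longleftrightarrow>
    0 < \<xi> \<and> \<xi> \<le> 2 / 3 * sin \<phi> * (sqrt (3 + (cos \<phi>)\<^sup>2) - cos \<phi>)"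
proof -
  define c s r where "c = cos \<phi>" and "s = sin \<phi>" and "r = sqrt (3 + (cos \<phi>)\<^sup>2)"
  have r2: "r\<^sup>2 = 3 + c\<^sup>2"
    by (simp add: r_def c_def)
  define \<xi>\<^sub>i where "\<xi>\<^sub>i = 2 / 3 * s * (r - c)"
  \<comment> \<open>The roots of the quadratic \<open>edge_coeff\<close> in the parameter are
    \<open>\<xi>\<^sub>i\<close> and \<open>-\<xi>'\<close>. For positive parameters its sign is
    therefore that of \<open>\<eta> - \<xi>\<^sub>i\<close>.\<close>
  define \<xi>' where "\<xi>' = 2 / 3 * s * (r + c)"
  have r: "c < r" "0 \<le> r"
    by (auto simp: r_def c_def intro: real_less_rsqrt)
  have cs: "0 < s" "0 \<le> c"
    using assms by (simp_all add: c_def s_def)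
  have pos: "0 < \<xi>\<^sub>i" "0 < \<xi>'"
    using r cs by (auto simp: \<xi>\<^sub>i_def \<xi>'_def)
  have factor: "edge_coeff \<phi> \<eta> = 9 / 16 * ((\<eta> - \<xi>\<^sub>i) * (\<eta> + \<xi>'))" for \<eta>
    unfolding edge_coeff_def \<xi>\<^sub>i_def \<xi>'_def c_def[symmetric] s_def[symmetric]
    using r2 by (simp add: field_simps) algebra
  \<comment> \<open>Only the term \<open>-cubic_coeff * (1 - t\<^sup>2)^3\<close> survives at
    \<open>\<xi>\<^sub>i\<close>; monotonicity then covers smaller parameters.\<close>
  have "radial_error \<phi> t \<xi>\<^sub>i \<le> 0" if "t \<in> {-1..1}" for t
  proof -
    have "t\<^sup>2 \<le> 1"
      using that by (simp add: abs_square_le_1 abs_le_iff)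
    then show ?thesis
      by (simp add: radial_error_eq factor cubic_coeff_nonneg mult_nonneg_nonpos)
  qed
  then have "inner_approximant \<phi> \<xi>" if "0 < \<xi>" "\<xi> \<le> \<xi>\<^sub>i"
    using that assms unfolding inner_approximant_def
    by (meson radial_error_mono order_trans)
  moreover have "0 < \<xi> \<and> \<xi> \<le> \<xi>\<^sub>i" if inner: "inner_approximant \<phi> \<xi>"
  proof
    show "0 < \<xi>"
      using inner by (simp add: inner_approximant_def)
    then show "\<xi> \<le> \<xi>\<^sub>i"
      using inner_approximant_imp_edge_coeff_nonpos[OF inner] pos
      by (simp add: factor mult_le_0_iff)
  qed
  ultimately show ?thesis
    unfolding \<xi>\<^sub>i_def c_def s_def r_def by blast
qed

section \<open>Optimality and uniqueness\<close>

lemma optimal_outer_iff: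
  assumes "0 < sin \<phi>" "0 \<le> cos \<phi>"
  shows "optimal_outer \<phi> \<xi> \<longleftrightarrow> \<xi> = 4 * sin \<phi> / (3 * (1 + cos \<phi>))"
proof -
  define \<xi>\<^sub>o where "\<xi>\<^sub>o = 4 * sin \<phi> / (3 * (1 + cos \<phi>))"
  have outer: "outer_approximant \<phi> \<eta> \<longleftrightarrow> \<xi>\<^sub>o \<le> \<eta>" for \<eta>
    unfolding \<xi>\<^sub>o_def using assms by (rule outer_approximant_iff)
  have less: "max_radial_error \<phi> \<xi>\<^sub>o < max_radial_error \<phi> \<eta>" if "\<xi>\<^sub>o < \<eta>" for \<eta>
  proof (rule max_radial_error_less)
    fix t :: real
    assume t: "t\<^sup>2 < 1"
    then have "t \<in> {-1..1}"
      using abs_square_less_1[of t] by auto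
    then have "0 \<le> radial_error \<phi> t \<xi>\<^sub>o" and "0 < \<xi>\<^sub>o"
      using outer[of \<xi>\<^sub>o] by (simp_all add: outer_approximant_def)
    \<comment> \<open>Nonnegative errors equal their absolute values, so growth in the parameter is
      growth of the absolute error.\<close>
    then show "\<bar>radial_error \<phi> t \<xi>\<^sub>o\<bar> < \<bar>radial_error \<phi> t \<eta>\<bar>"
      using radial_error_strict_mono[OF assms _ that t] by linarith
  qed
  show ?thesis
    unfolding optimal_outer_def outer \<xi>\<^sub>o_def[symmetric]
    using less by (metis leD le_less order_refl)
qed

lemma optimal_inner_iff:
  assumes "0 < sin \<phi>" "0 \<le> cos \<phi>"
  shows "optimal_inner \<phi> \<xi> \<longleftrightarrow> \<xi> = 2 / 3 * sin \<phi> * (sqrt (3 + (cos \<phi>)\<^sup>2) - cos \<phi>)"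
proof -
  define \<xi>\<^sub>i where "\<xi>\<^sub>i = 2 / 3 * sin \<phi> * (sqrt (3 + (cos \<phi>)\<^sup>2) - cos \<phi>)"
  have inner: "inner_approximant \<phi> \<eta> \<longleftrightarrow> 0 < \<eta> \<and> \<eta> \<le> \<xi>\<^sub>i" for \<eta>
    unfolding \<xi>\<^sub>i_def using assms by (rule inner_approximant_iff)
  have pos: "0 < \<xi>\<^sub>i"
    using assms by (auto simp: \<xi>\<^sub>i_def intro!: mult_pos_pos real_less_rsqrt)
  have less: "max_radial_error \<phi> \<xi>\<^sub>i < max_radial_error \<phi> \<eta>" if "0 < \<eta>" "\<eta> < \<xi>\<^sub>i" for \<eta>
  proof (rule max_radial_error_less)
    fix t :: real
    assume t: "t\<^sup>2 < 1"
    then have "t \<in> {-1..1}"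
      using abs_square_less_1[of t] by auto
    then have "radial_error \<phi> t \<xi>\<^sub>i \<le> 0"
      using inner[of \<xi>\<^sub>i] pos by (simp add: inner_approximant_def)
    \<comment> \<open>The signs are now nonpositive: lowering the parameter enlarges the absolute
      error, and the largest inner parameter wins.\<close>
    then show "\<bar>radial_error \<phi> t \<xi>\<^sub>i\<bar> < \<bar>radial_error \<phi> t \<eta>\<bar>"
      using radial_error_strict_mono[OF assms that t] by linarith
  qed
  show ?thesis
    unfolding optimal_inner_def inner \<xi>\<^sub>i_def[symmetric]
    using less pos by (metis leD le_less order_refl)
qed

theorem mainTheorem4:
  fixes \<phi> c :: real
  assumes "0 < \<phi>" and "\<phi> \<le> pi / 2" and "c = cos \<phi>"
  shows "(\<forall>\<xi>. optimal_outer \<phi> \<xi> \<longleftrightarrow> \<xi> = 4 * sqrt (1 - c\<^sup>2) / (3 * (1 + c)))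
    \<and> (\<forall>\<xi>. optimal_inner \<phi> \<xi> \<longleftrightarrow> \<xi> = 2 / 3 * sqrt (1 - c\<^sup>2) * (sqrt (3 + c\<^sup>2) - c))"
proof -
  have sin: "0 < sin \<phi>" and cos: "0 \<le> cos \<phi>"
    using assms by (auto intro: sin_gt_zero cos_ge_zero)
  have "sqrt (1 - c\<^sup>2) = sin \<phi>"
    using sin assms(3) by (simp add: sin_squared_eq[symmetric])
  then show ?thesis
    using optimal_outer_iff[OF sin cos] optimal_inner_iff[OF sin cos] assms(3) by simp
qed

end
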